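(* Let $X$ be a Banach space and let $C\subset X$ be a nonempty weakly compact convex set having the weak Banach–Saks property. Then every $\mathfrak{cm}$-nonexpansive map $T\colon C\to C$ has a fixed point.
   Context: A subset $K$ of a Banach space has the weak Banach–Saks property if whenever $(x_n)\subset K$ converges weakly to $x$, there is a subsequence $(y_i)$ of $(x_n)$ such that $\frac1n\sum_{i=1}^n y_i\to x$ in norm. For a bounded convex set $C$, a nonexpansive map $T\colon C\to C$ (i.e. $\|Tx-Ty\|\le\|x-y\|$) is $\mathfrak{cm}$-nonexpansive if for all $n\in\mathbb{N}$, $y\in C$ and sequences $(u_i)_{i=1}^\infty\subset C$: $\limsup_{i\to\infty}\sup_{A\subset\{1,\dots,n\}}\|\sum_{k\in A}(Tu_{i+k}-Ty)\|\le\limsup_{i\to\infty}\sup_{A\subset\{1,\dots,n\}}\|\sum_{k\in A}(u_{i+k}-y)\|$. *)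

theory Defs
  imports "HOL-Analysis.Analysis" "HOL-Library.Liminf_Limsup"
begin

definition weak_topology :: "'a::real_normed_vector topology" where
  "weak_topology = topology_generated_by
     {f -` U | f U. bounded_linear (f :: 'a \<Rightarrow> real) \<and> open U}"

definition weakly_compact :: "'a::real_normed_vector set \<Rightarrow> bool" where
  "weakly_compact K \<longleftrightarrow> compactin weak_topology K"

definition weakly_converges :: "(nat \<Rightarrow> 'a::real_normed_vector) \<Rightarrow> 'a \<Rightarrow> bool" where
  "weakly_converges x l \<longleftrightarrow> limitin weak_topology x l sequentially"

definition weak_banach_saks :: "'a::real_normed_vector set \<Rightarrow> bool" where
  "weak_banach_saks K \<longleftrightarrow>
     (\<forall>x l. (\<forall>n. x n \<in> K) \<and> weakly_converges x l \<longrightarrow>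
        (\<exists>r. strict_mono r \<and>
           (\<lambda>n. (1 / real n) *\<^sub>R (\<Sum>i<n. x (r i))) \<longlonglongrightarrow> l))"

definition nonexpansive_on :: "'a::real_normed_vector set \<Rightarrow> ('a \<Rightarrow> 'a) \<Rightarrow> bool" where
  "nonexpansive_on C T \<longleftrightarrow> (\<forall>x\<in>C. \<forall>y\<in>C. norm (T x - T y) \<le> norm (x - y))"

definition cm_quantity :: "nat \<Rightarrow> (nat \<Rightarrow> 'a::real_normed_vector) \<Rightarrow> 'a \<Rightarrow> ereal" where
  "cm_quantity n u y =
     limsup (\<lambda>i. SUP A\<in>Pow {1..n}. ereal (norm (\<Sum>k\<in>A. u (i + k) - y)))"

definition cm_nonexpansive :: "'a::real_normed_vector set \<Rightarrow> ('a \<Rightarrow> 'a) \<Rightarrow> bool" where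
  "cm_nonexpansive C T \<longleftrightarrow>
     T ` C \<subseteq> C \<and> nonexpansive_on C T \<and>
     (\<forall>n::nat. \<forall>y\<in>C. \<forall>u::nat \<Rightarrow> 'a. (\<forall>i. u i \<in> C) \<longrightarrow>
        cm_quantity n (\<lambda>i. T (u i)) (T y) \<le> cm_quantity n u y)"

end

theory Submission
  imports Defs "HOL-Library.Diagonal_Subsequence" "HOL-Library.Ramsey"
begin

text \<open>Let \<open>K\<close> be a minimal nonempty closed convex \<open>T\<close>-invariant subset of \<open>C\<close>, and take an approximate
  fixed point sequence in \<open>K\<close>, weakly convergent to some \<open>x \<in> K\<close>. Ramsey's theorem and the weak
  Banach--Saks property give, for each \<open>\<epsilon> > 0\<close>, some \<open>n \<ge> 1\<close> and a subsequence \<open>u\<close> all of whose sums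
  \<open>\<Sum>\<^sub>A (u\<^sub>k - x)\<close> with \<open>|A| \<le> n\<close> have norm at most \<open>\<epsilon> n\<close>. As \<open>u\<close> is asymptotically fixed, the set of
  \<open>y \<in> K\<close> whose cm-quantity relative to \<open>u\<close> is at most \<open>\<epsilon> n\<close> is closed, convex and \<open>T\<close>-invariant, and it
  contains \<open>x\<close>; by minimality it is \<open>K\<close>. But the cm-quantity of \<open>y\<close> is at least \<open>n \<parallel>x - y\<parallel>\<close>, so
  \<open>\<parallel>x - y\<parallel> \<le> \<epsilon>\<close> for all \<open>y \<in> K\<close>, and \<open>K = {x}\<close>.\<close>

subsection \<open>Separation by bounded linear functionals\<close>

definition sublinear :: "('a::real_vector \<Rightarrow> real) \<Rightarrow> bool" where
  "sublinear p \<longleftrightarrow> (\<forall>x y. p (x + y) \<le> p x + p y) \<and> (\<forall>t\<ge>0. \<forall>x. p (t *\<^sub>R x) = t * p x)"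

text \<open>One inequality for positive \<open>t\<close> suffices: applied to
  \<open>inverse t\<close> and the scaled vector, it yields the reverse one.\<close>

lemma sublinearI:
  assumes "\<And>x y. p (x + y) \<le> p x + p y" and "p 0 = 0"
    and "\<And>t x. t > 0 \<Longrightarrow> p (t *\<^sub>R x) \<le> t * p x"
  shows "sublinear p"
proof -
  have "p (t *\<^sub>R x) = t * p x" if "t \<ge> 0" for t x
  proof (cases "t = 0")
    case False
    with that have t: "t > 0" by simp
    have "p (inverse t *\<^sub>R (t *\<^sub>R x)) \<le> inverse t * p (t *\<^sub>R x)"
      using t by (intro assms) simp
    then have "t * p x \<le> p (t *\<^sub>R x)"
      using t by (simp add: field_simps)
    then show ?thesis using assms(3)[OF t, of x] by simp
  qed (simp add: assms)
  then show ?thesis using assms(1) by (simp add: sublinear_def)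
qed

lemma sublinear_add: "sublinear p \<Longrightarrow> p (x + y) \<le> p x + p y"
  and sublinear_scaleR: "sublinear p \<Longrightarrow> t \<ge> 0 \<Longrightarrow> p (t *\<^sub>R x) = t * p x"
  by (auto simp: sublinear_def)

lemma sublinear_zero: "sublinear p \<Longrightarrow> p 0 = 0"
  using sublinear_scaleR[of p 0] by simp

lemma sublinear_minus: "sublinear p \<Longrightarrow> - p (- x) \<le> p x"
  using sublinear_add[of p x "- x"] by (simp add: sublinear_zero)

text \<open>Zorn's lemma for the reversed pointwise order. A nonempty chain below \<open>p\<close>
  has its pointwise infimum as lower bound, which is finite because each member \<open>q\<close>
  satisfies \<open>q x \<ge> - q (- x) \<ge> - p (- x)\<close>.\<close>

lemma sublinear_minimal_exists:
  fixes p :: "'a::real_vector \<Rightarrow> real"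
  assumes "sublinear p"
  obtains m where "sublinear m" "m \<le> p" "\<And>q. sublinear q \<Longrightarrow> q \<le> m \<Longrightarrow> q = m"
proof -
  define A where "A = {q. sublinear q \<and> q \<le> p}"
  have "\<exists>m\<in>A. \<forall>q\<in>A. q \<le> m \<longrightarrow> q = m"
  proof (rule predicate_Zorn)
    show "partial_order_on A (relation_of (\<lambda>a b. b \<le> a) A)"
      by (rule partial_order_on_relation_ofI) auto
  next
    fix K assume K: "K \<in> Chains (relation_of (\<lambda>a b. b \<le> a) A)"
    then have KA: "K \<subseteq> A" and tot: "\<And>a b. a \<in> K \<Longrightarrow> b \<in> K \<Longrightarrow> a \<le> b \<or> b \<le> a"
      by (auto simp: Chains_def relation_of_def)
    show "\<exists>u\<in>A. \<forall>a\<in>K. u \<le> a"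
    proof (cases "K = {}")
      case True
      then show ?thesis using assms by (auto simp: A_def)
    next
      case False
      define u where "u = (\<lambda>x. INF q\<in>K. q x)"
      have low: "- p (- x) \<le> q x" if "q \<in> K" for q x
      proof -
        have "sublinear q" "q (- x) \<le> p (- x)" using that KA by (auto simp: A_def le_fun_def)
        then show ?thesis using sublinear_minus[of q x] by linarith
      qed
      have bdd: "bdd_below ((\<lambda>q. q x) ` K)" for x
        using low by (auto intro!: bdd_belowI2)
      have ule: "u x \<le> q x" if "q \<in> K" for q x
        unfolding u_def using bdd that by (rule cINF_lower)
      have "sublinear u"
      proof (rule sublinearI)
        fix x y
        have "u (x + y) - q y \<le> u x" if q: "q \<in> K" for q
          unfolding u_def[THEN fun_cong, of x]
        proof (rule cINF_greatest[OF False])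
          fix q' assume q': "q' \<in> K"
          \<comment> \<open>Subadditivity survives the infimum because two members of a chain have a
            common lower bound in it.\<close>
          obtain r where r: "r \<in> K" "r \<le> q" "r \<le> q'" using tot[OF q q'] q q' by blast
          have "u (x + y) \<le> r (x + y)" using r ule by blast
          also have "\<dots> \<le> r x + r y" using r KA by (auto simp: A_def intro: sublinear_add)
          also have "\<dots> \<le> q' x + q y" using r by (simp add: le_fun_def add_mono)
          finally show "u (x + y) - q y \<le> q' x" by simp
        qed
        then have "u (x + y) - u x \<le> u y"
          unfolding u_def[THEN fun_cong, of y]
          by (intro cINF_greatest[OF False]) (simp add: algebra_simps)
        then show "u (x + y) \<le> u x + u y" by simp
      next
        have "(\<lambda>q. q 0) ` K = {0}"
        proof -
          have "q 0 = 0" if "q \<in> K" for q using that KA by (auto simp: A_def intro: sublinear_zero)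
          then show ?thesis using False by force
        qed
        then show "u 0 = 0" by (simp add: u_def)
      next
        fix t :: real and x assume t: "t > 0"
        have "u (t *\<^sub>R x) / t \<le> u x"
          unfolding u_def[THEN fun_cong, of x]
        proof (rule cINF_greatest[OF False])
          fix q assume q: "q \<in> K"
          then have "q (t *\<^sub>R x) = t * q x" using KA t by (auto simp: A_def intro: sublinear_scaleR)
          then show "u (t *\<^sub>R x) / t \<le> q x" using ule[OF q, of "t *\<^sub>R x"] t by (simp add: field_simps)
        qed
        then show "u (t *\<^sub>R x) \<le> t * u x" using t by (simp add: field_simps)
      qed
      moreover have "u \<le> p"
      proof -
        obtain q where q: "q \<in> K" using False by blast
        then have "u \<le> q" "q \<le> p" using ule KA by (auto simp: le_fun_def A_def)
        then show ?thesis by (rule order_trans)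
      qed
      ultimately show ?thesis using ule by (auto simp: A_def le_fun_def)
    qed
  qed
  then obtain m where m: "m \<in> A" "\<And>q. q \<in> A \<Longrightarrow> q \<le> m \<Longrightarrow> q = m" by blast
  show thesis
  proof (rule that)
    show "sublinear m" "m \<le> p" using m(1) by (auto simp: A_def)
    then show "q = m" if "sublinear q" "q \<le> m" for q
      using that order_trans[of q m p] by (intro m(2)) (simp_all add: A_def)
  qed
qed

text \<open>The functional \<open>q\<close> lowers \<open>p\<close> along the ray through
  \<open>y\<close> and is again sublinear, so minimality forces \<open>q = p\<close>. Taking
  \<open>t = 1\<close> at the point \<open>- y\<close> then gives
  \<open>p (- y) \<le> - p y\<close>.\<close>

lemma sublinear_minimal_imp_odd:
  fixes p :: "'a::real_vector \<Rightarrow> real"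
  assumes p: "sublinear p" and min: "\<And>q. sublinear q \<Longrightarrow> q \<le> p \<Longrightarrow> q = p"
  shows "p (- y) = - p y"
proof -
  define q where "q = (\<lambda>x. INF t\<in>{0..}. p (x + t *\<^sub>R y) - t * p y)"
  have low: "- p (- x) \<le> p (x + t *\<^sub>R y) - t * p y" if "t \<ge> 0" for x t
    using sublinear_add[OF p, of "x + t *\<^sub>R y" "- x"] sublinear_scaleR[OF p that, of y]
    by simp
  have bdd: "bdd_below ((\<lambda>t. p (x + t *\<^sub>R y) - t * p y) ` {0..})" for x
    using low by (auto intro!: bdd_belowI2)
  have qle: "q x \<le> p (x + t *\<^sub>R y) - t * p y" if "t \<ge> 0" for x t
    unfolding q_def using bdd that by (intro cINF_lower) auto
  have "sublinear q"
  proof (rule sublinearI)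
    fix x z
    have *: "q (x + z) \<le> (p (x + t *\<^sub>R y) - t * p y) + (p (z + s *\<^sub>R y) - s * p y)"
      if "t \<ge> 0" "s \<ge> 0" for t s
      using qle[of "t + s" "x + z"] that sublinear_add[OF p, of "x + t *\<^sub>R y" "z + s *\<^sub>R y"]
      by (simp add: algebra_simps)
    have "q (x + z) - (p (z + s *\<^sub>R y) - s * p y) \<le> q x" if "s \<ge> 0" for s
      unfolding q_def[THEN fun_cong, of x]
      by (rule cINF_greatest) (use *[OF _ that] in \<open>auto simp: algebra_simps\<close>)
    then have "q (x + z) - q x \<le> q z"
      unfolding q_def[THEN fun_cong, of z]
      by (intro cINF_greatest) (auto simp: algebra_simps)
    then show "q (x + z) \<le> q x + q z" by simp
  next
    have "(\<lambda>t. p (0 + t *\<^sub>R y) - t * p y) ` {0..} = {0}"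
      using sublinear_scaleR[OF p, of _ y] by (auto simp: image_iff)
    then show "q 0 = 0" by (simp add: q_def)
  next
    fix s :: real and x assume s: "s > 0"
    have "q (s *\<^sub>R x) / s \<le> q x"
      unfolding q_def[THEN fun_cong, of x]
    proof (rule cINF_greatest)
      fix t :: real assume t: "t \<in> {0..}"
      have "p (s *\<^sub>R x + (s * t) *\<^sub>R y) = s * p (x + t *\<^sub>R y)"
        using sublinear_scaleR[OF p, of s "x + t *\<^sub>R y"] s by (simp add: algebra_simps)
      then show "q (s *\<^sub>R x) / s \<le> p (x + t *\<^sub>R y) - t * p y"
        using qle[of "s * t" "s *\<^sub>R x"] s t by (simp add: field_simps)
    qed auto
    then show "q (s *\<^sub>R x) \<le> s * q x" using s by (simp add: field_simps)
  qed
  moreover have "q \<le> p" using qle[of 0] by (simp add: le_fun_def)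
  ultimately have "q = p" by (rule min)
  then have "p (- y) \<le> - p y" using qle[of 1 "- y"] sublinear_zero[OF p] by simp
  then show ?thesis using sublinear_minus[OF p, of y] by linarith
qed

text \<open>Oddness turns the subadditivity and positive homogeneity of a minimal sublinear
  functional into linearity.\<close>

lemma sublinear_linear_minorant:
  fixes p :: "'a::real_vector \<Rightarrow> real"
  assumes "sublinear p"
  obtains f where "linear f" "\<And>x. f x \<le> p x"
proof -
  obtain f where f: "sublinear f" "f \<le> p" and min: "\<And>q. sublinear q \<Longrightarrow> q \<le> f \<Longrightarrow> q = f"
    using sublinear_minimal_exists[OF assms] by blast
  note odd = sublinear_minimal_imp_odd[OF f(1) min]
  have "linear f"
  proof (rule linearI)
    show "f (x + y) = f x + f y" for x y
      using sublinear_add[OF f(1), of x y] sublinear_add[OF f(1), of "x + y" "- y"] odd[of y] by simp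
    show "f (c *\<^sub>R x) = c *\<^sub>R f x" for c x
    proof (cases "c \<ge> 0")
      case True
      then show ?thesis using sublinear_scaleR[OF f(1)] by simp
    next
      case False
      then show ?thesis using sublinear_scaleR[OF f(1), of "- c" x] odd[of "c *\<^sub>R x"] by simp
    qed
  qed
  then show thesis using that f(2) by (auto simp: le_fun_def)
qed

text \<open>The functional is a linear minorant of the infimum of \<open>\<parallel>v + t (s - x)\<parallel> - t r\<close> over
  \<open>t \<ge> 0\<close> and \<open>s \<in> S\<close>, which lies below the norm and is at most \<open>-r\<close> at \<open>x - s\<close>.\<close>

lemma separating_functional:
  fixes S :: "'a::real_normed_vector set"
  assumes "convex S" "S \<noteq> {}" and r: "\<And>s. s \<in> S \<Longrightarrow> r \<le> norm (s - x)"
  obtains f :: "'a \<Rightarrow> real" where "bounded_linear f" "\<And>v. \<bar>f v\<bar> \<le> norm v" "\<And>s. s \<in> S \<Longrightarrow> f x + r \<le> f s"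
proof -
  define I where "I = ({0..} :: real set) \<times> S"
  define h where "h = (\<lambda>v (t, s). norm (v + t *\<^sub>R (s - x)) - t * r)"
  define p where "p = (\<lambda>v. INF i\<in>I. h v i)"
  have I: "I \<noteq> {}" using assms by (auto simp: I_def)
  \<comment> \<open>The gap \<open>r\<close> between \<open>x\<close> and \<open>S\<close> is what
    keeps the infimum \<open>p\<close> finite.\<close>
  have low: "- norm v \<le> h v i" if iI: "i \<in> I" for v i
  proof -
    obtain t s where i: "i = (t, s)" "t \<ge> 0" "s \<in> S" using iI by (auto simp: I_def)
    have "t * r \<le> norm (t *\<^sub>R (s - x))" using i r by (simp add: mult_left_mono)
    also have "\<dots> \<le> norm (v + t *\<^sub>R (s - x)) + norm v"
      using norm_triangle_ineq4[of "v + t *\<^sub>R (s - x)" v] by simp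
    finally show ?thesis by (simp add: h_def i)
  qed
  have bdd: "bdd_below (h v ` I)" for v
    using low by (auto intro!: bdd_belowI2)
  have ple: "p v \<le> norm (v + t *\<^sub>R (s - x)) - t * r" if "t \<ge> 0" "s \<in> S" for v t s
    unfolding p_def using cINF_lower[OF bdd, of "(t, s)" v] that by (auto simp: I_def h_def)
  have pnorm: "p v \<le> norm v" for v
    using ple[of 0 _ v] assms(2) by auto
  have "sublinear p"
  proof (rule sublinearI)
    fix v w
    have *: "p (v + w) \<le> h v i + h w j" if ij: "i \<in> I" "j \<in> I" for i j
    proof -
      obtain t s where i: "i = (t, s)" "t \<ge> 0" "s \<in> S" using ij by (auto simp: I_def)
      obtain t' s' where j: "j = (t', s')" "t' \<ge> 0" "s' \<in> S" using ij by (auto simp: I_def)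
      \<comment> \<open>Convexity of \<open>S\<close> merges two competitors of the infimum into
        one: \<open>s''\<close> is the mean of \<open>s\<close> and \<open>s'\<close> with weights
        proportional to \<open>t\<close> and \<open>t'\<close>.\<close>
      obtain s'' where s'': "s'' \<in> S" "(t + t') *\<^sub>R s'' = t *\<^sub>R s + t' *\<^sub>R s'"
      proof (cases "t + t' = 0")
        case True
        then have "t = 0" "t' = 0" using i j by linarith+
        then show ?thesis by (intro that[of s]) (use i in auto)
      next
        case False
        show ?thesis
        proof (rule that)
          show "(t / (t + t')) *\<^sub>R s + (t' / (t + t')) *\<^sub>R s' \<in> S"
            using i j False by (intro convexD[OF assms(1)]) (auto simp: add_divide_distrib[symmetric])
        qed (use False in \<open>simp add: scaleR_add_right\<close>)
      qed
      have "p (v + w) \<le> norm (v + w + (t + t') *\<^sub>R (s'' - x)) - (t + t') * r"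
        using ple i j s'' by simp
      also have "v + w + (t + t') *\<^sub>R (s'' - x) = (v + t *\<^sub>R (s - x)) + (w + t' *\<^sub>R (s' - x))"
        unfolding scaleR_diff_right s''(2) by (simp add: algebra_simps)
      also have "norm \<dots> - (t + t') * r \<le> h v i + h w j"
        using norm_triangle_ineq[of "v + t *\<^sub>R (s - x)" "w + t' *\<^sub>R (s' - x)"]
        by (simp add: h_def i j algebra_simps)
      finally show ?thesis .
    qed
    have "p (v + w) - h w j \<le> p v" if "j \<in> I" for j
      unfolding p_def[THEN fun_cong, of v]
      by (rule cINF_greatest[OF I]) (use *[OF _ that] in \<open>auto simp: algebra_simps\<close>)
    then have "p (v + w) - p v \<le> p w"
      unfolding p_def[THEN fun_cong, of w]
      by (intro cINF_greatest[OF I]) (auto simp: algebra_simps)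
    then show "p (v + w) \<le> p v + p w" by simp
  next
    have "0 \<le> p 0" unfolding p_def using low[of _ 0] by (intro cINF_greatest[OF I]) auto
    then show "p 0 = 0" using pnorm[of 0] by simp
  next
    fix c :: real and v assume c: "c > 0"
    have "p (c *\<^sub>R v) / c \<le> p v"
      unfolding p_def[THEN fun_cong, of v]
    proof (rule cINF_greatest[OF I])
      fix i assume "i \<in> I"
      then obtain t s where i: "i = (t, s)" "t \<ge> 0" "s \<in> S" by (auto simp: I_def)
      have "p (c *\<^sub>R v) \<le> norm (c *\<^sub>R v + (c * t) *\<^sub>R (s - x)) - c * t * r"
        using ple i c by simp
      also have "c *\<^sub>R v + (c * t) *\<^sub>R (s - x) = c *\<^sub>R (v + t *\<^sub>R (s - x))"
        by (simp add: algebra_simps)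
      also have "norm \<dots> - c * t * r = c * h v i"
        using c by (simp add: h_def i right_diff_distrib)
      finally show "p (c *\<^sub>R v) / c \<le> h v i" using c by (simp add: field_simps)
    qed
    then show "p (c *\<^sub>R v) \<le> c * p v" using c by (simp add: field_simps)
  qed
  then obtain f where f: "linear f" "\<And>v. f v \<le> p v" using sublinear_linear_minorant by blast
  have fn: "\<bar>f v\<bar> \<le> norm v" for v
    using f(2)[of v] f(2)[of "- v"] pnorm[of v] pnorm[of "- v"] linear_neg[OF f(1), of v] by simp
  have "bounded_linear f"
    using f(1) fn by (intro bounded_linear.intro bounded_linear_axioms.intro exI[of _ 1]) auto
  moreover have "f x + r \<le> f s" if "s \<in> S" for s
    using f(2)[of "x - s"] ple[of 1 s "x - s"] that by (simp add: linear_diff[OF f(1)])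
  ultimately show thesis using fn that by blast
qed

text \<open>Separating 0 from the singleton \<open>{x}\<close> with gap \<open>norm x\<close> gives
  \<open>f x \<ge> norm x\<close>; the norm bound on \<open>f\<close> gives the converse.\<close>

lemma norming_functional:
  fixes x :: "'a::real_normed_vector"
  obtains f :: "'a \<Rightarrow> real" where "bounded_linear f" "\<And>v. \<bar>f v\<bar> \<le> norm v" "f x = norm x"
proof -
  obtain f :: "'a \<Rightarrow> real" where f: "bounded_linear f" "\<And>v. \<bar>f v\<bar> \<le> norm v" "f 0 + norm x \<le> f x"
    using separating_functional[of "{x}" "norm x" 0] by auto
  have "f x = norm x"
    using f(2)[of x] f(3) linear_0[OF bounded_linear.linear[OF f(1)]] by simp
  then show thesis using that f by blast
qed

subsection \<open>The weak topology\<close>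

lemma topspace_weak_topology [simp]: "topspace (weak_topology :: 'a::real_normed_vector topology) = UNIV"
proof -
  have "bounded_linear (\<lambda>x::'a. 0::real)" by simp
  then show ?thesis unfolding weak_topology_def topology_generated_by_topspace by blast
qed

lemma openin_weak_topology_vimage:
  assumes "bounded_linear (f :: 'a::real_normed_vector \<Rightarrow> real)" "open U"
  shows "openin weak_topology (f -` U)"
  unfolding weak_topology_def using assms by (intro topology_generated_by_Basis) blast

lemma openin_weak_topology_imp_open:
  assumes "openin weak_topology (U :: 'a::real_normed_vector set)"
  shows "open U"
proof -
  have "generate_topology_on {f -` U | f U. bounded_linear (f :: 'a \<Rightarrow> real) \<and> open U} U"
    using assms by (simp add: weak_topology_def openin_topology_generated_by_iff)
  then show ?thesis
  proof induction
    case (Basis s)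
    then show ?case by (auto intro!: open_vimage linear_continuous_on)
  qed auto
qed

lemma closedin_weak_topology_imp_closed: "closedin weak_topology U \<Longrightarrow> closed U"
  by (simp add: closedin_def closed_def Compl_eq_Diff_UNIV[symmetric] openin_weak_topology_imp_open)

lemma Hausdorff_weak_topology: "Hausdorff_space (weak_topology :: 'a::real_normed_vector topology)"
  unfolding Hausdorff_space_def
proof (intro allI impI)
  fix x y :: 'a assume xy: "x \<in> topspace weak_topology \<and> y \<in> topspace weak_topology \<and> x \<noteq> y"
  obtain f :: "'a \<Rightarrow> real" where f: "bounded_linear f" "f (x - y) = norm (x - y)"
    using norming_functional by blast
  moreover have "f (x - y) = f x - f y" using f(1) by (simp add: linear_diff[OF bounded_linear.linear])
  ultimately have "f x \<noteq> f y" using xy by auto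
  then obtain U V where "open U" "open V" "f x \<in> U" "f y \<in> V" "U \<inter> V = {}"
    by (rule hausdorff[THEN exE]) blast
  then show "\<exists>U V. openin weak_topology U \<and> openin weak_topology V \<and> x \<in> U \<and> y \<in> V \<and> disjnt U V"
  proof (intro exI conjI)
    show "openin weak_topology (f -` U)" "openin weak_topology (f -` V)"
      using \<open>open U\<close> \<open>open V\<close> by (auto intro: openin_weak_topology_vimage f(1))
  qed (auto simp: disjnt_def)
qed

lemma weakly_compact_imp_closed: "weakly_compact C \<Longrightarrow> closed C"
  by (simp add: weakly_compact_def closedin_weak_topology_imp_closed compactin_imp_closedin
      Hausdorff_weak_topology)

text \<open>Mazur's theorem: a point outside \<open>S\<close> has positive distance \<open>r\<close>
  from it, and a functional separating with gap \<open>r\<close> provides a weakly open half-space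
  around the point that misses \<open>S\<close>.\<close>

lemma closed_convex_imp_closedin_weak:
  fixes S :: "'a::real_normed_vector set"
  assumes "closed S" "convex S"
  shows "closedin weak_topology S"
proof (cases "S = {}")
  case False
  have "openin weak_topology (- S)"
  proof (subst openin_subopen, intro ballI)
    fix x assume x: "x \<in> - S"
    define r where "r = infdist x S"
    have r: "r > 0" using x assms False by (simp add: r_def infdist_pos_not_in_closed)
    have "r \<le> norm (s - x)" if "s \<in> S" for s
      using infdist_le[OF that, of x] by (simp add: r_def dist_norm norm_minus_commute)
    then obtain f :: "'a \<Rightarrow> real" where f: "bounded_linear f" "\<And>s. s \<in> S \<Longrightarrow> f x + r \<le> f s"
      using separating_functional[OF assms(2) False, of r x] by metis
    show "\<exists>T. openin weak_topology T \<and> x \<in> T \<and> T \<subseteq> - S"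
    proof (intro exI conjI)
      show "openin weak_topology (f -` {..<f x + r})"
        by (rule openin_weak_topology_vimage[OF f(1)]) simp
      show "x \<in> f -` {..<f x + r}" using r by simp
      show "f -` {..<f x + r} \<subseteq> - S" using f(2) by force
    qed
  qed
  then show ?thesis by (simp add: closedin_def Compl_eq_Diff_UNIV[symmetric])
qed simp

section \<open>Boundedness and sequential compactness of weakly compact sets\<close>

lemma compactin_indexed_subcover:
  assumes "compactin X S" "\<And>i. i \<in> I \<Longrightarrow> openin X (U i)" "S \<subseteq> (\<Union>i\<in>I. U i)"
  obtains J where "finite J" "J \<subseteq> I" "S \<subseteq> (\<Union>i\<in>J. U i)"
proof -
  have "\<exists>\<F>. finite \<F> \<and> \<F> \<subseteq> U ` I \<and> S \<subseteq> \<Union>\<F>"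
    using assms by (intro compactinD[where X=X]) auto
  then obtain \<F> where F: "finite \<F>" "\<F> \<subseteq> U ` I" "S \<subseteq> \<Union>\<F>" by blast
  obtain J where "J \<subseteq> I" "finite J" "\<F> = U ` J" using finite_subset_image[OF F(1,2)] by blast
  then show thesis using that F(3) by blast
qed

text \<open>Baire's theorem in the dual space gives a ball of functionals uniformly bounded on \<open>C\<close>.\<close>

lemma weakly_compact_imp_bounded:
  fixes C :: "'a::real_normed_vector set"
  assumes "weakly_compact C"
  shows "bounded C"
proof -
  define F where "F = (\<lambda>n::nat. {f :: 'a \<Rightarrow>\<^sub>L real. \<forall>k\<in>C. \<bar>blinfun_apply f k\<bar> \<le> real n})"
  have Fclosed: "closed (F n)" for n
  proof -
    have "F n = (\<Inter>k\<in>C. {f. \<bar>blinfun_apply f k\<bar> \<le> real n})" by (auto simp: F_def)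
    then show ?thesis by (auto intro!: closed_Collect_le continuous_intros)
  qed
  \<comment> \<open>Each single functional is weakly continuous, hence bounded on \<open>C\<close>:
    the preimages of the intervals from \<open>- n\<close> to \<open>n\<close> form an open
    cover.\<close>
  have "f \<in> (\<Union>n. F n)" for f
  proof -
    have f: "bounded_linear (blinfun_apply f)" by (rule blinfun.bounded_linear_right)
    obtain N where N: "finite N" "C \<subseteq> (\<Union>n\<in>N. f -` {- real n<..<real n})"
    proof (rule compactin_indexed_subcover)
      show "compactin weak_topology C" using assms by (simp add: weakly_compact_def)
      show "openin weak_topology (f -` {- real n<..<real n})" for n
        by (intro openin_weak_topology_vimage f) simp
      show "C \<subseteq> (\<Union>n. f -` {- real n<..<real n})"
      proof
        fix k
        obtain n :: nat where "\<bar>f k\<bar> < real n" using reals_Archimedean2 by blast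
        then have "k \<in> f -` {- real n<..<real n}" by auto
        then show "k \<in> (\<Union>n. f -` {- real n<..<real n})" by blast
      qed
    qed blast
    have "\<bar>f k\<bar> \<le> real (Max N)" if k: "k \<in> C" for k
    proof -
      obtain n where n: "n \<in> N" "k \<in> f -` {- real n<..<real n}" using N(2) k by blast
      then have "n \<le> Max N" using N(1) by simp
      then show ?thesis using n(2) by auto
    qed
    then show ?thesis by (auto simp: F_def)
  qed
  then have "(\<Union>n. F n) = UNIV" by auto
  moreover have "euclidean interior_of \<Union>(range F) = {}" if "\<And>n. interior (F n) = {}"
    by (rule Baire_category_alt)
      (auto simp: completely_metrizable_space_euclidean Fclosed that closed_closedin[symmetric])
  ultimately obtain n where "interior (F n) \<noteq> {}" by auto
  then obtain g where "g \<in> interior (F n)" by blast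
  then obtain e where e: "e > 0" and ge: "cball g e \<subseteq> F n"
    by (auto simp: mem_interior_cball)
  have "norm k \<le> 2 * real n / e" if k: "k \<in> C" for k
  proof -
    obtain f :: "'a \<Rightarrow> real" where f: "bounded_linear f" "\<And>v. \<bar>f v\<bar> \<le> norm v" "f k = norm k"
      using norming_functional by blast
    have nf: "norm (Blinfun f) \<le> 1"
      using f by (intro norm_blinfun_bound) (auto simp: bounded_linear_Blinfun_apply)
    \<comment> \<open>Subtracting the centre \<open>g\<close> of the ball leaves \<open>e\<close>
      times a functional norming \<open>k\<close>, so \<open>e * norm k\<close> is at most twice the
      bound \<open>n\<close>.\<close>
    have "g + e *\<^sub>R Blinfun f \<in> F n" "g \<in> F n"
      using ge nf e by (auto intro!: subsetD[OF ge] simp: dist_norm)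
    then have "\<bar>g k + e * norm k\<bar> \<le> n" "\<bar>g k\<bar> \<le> n"
      using k f by (auto simp: F_def blinfun.add_left blinfun.scaleR_left bounded_linear_Blinfun_apply)
    then have "e * norm k \<le> 2 * real n" by linarith
    then show ?thesis using e by (simp add: field_simps)
  qed
  then show ?thesis by (auto simp: bounded_iff)
qed

text \<open>Otherwise finitely many neighbourhoods, each eventually avoided at the indices
  satisfying \<open>P\<close>, would cover \<open>C\<close>. The predicate \<open>P\<close> allows
  cluster points along a chosen set of indices, with no need to pass to a subsequence.\<close>

lemma compactin_frequently_cluster:
  assumes "compactin X C" "\<exists>\<^sub>F i in F. P i" "\<And>i. u i \<in> C"
  shows "\<exists>z\<in>C. \<forall>U. openin X U \<longrightarrow> z \<in> U \<longrightarrow> (\<exists>\<^sub>F i in F. P i \<and> u i \<in> U)"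
proof (rule ccontr)
  assume "\<not> ?thesis"
  then have "\<forall>z\<in>C. \<exists>U. openin X U \<and> z \<in> U \<and> (\<forall>\<^sub>F i in F. P i \<longrightarrow> u i \<notin> U)"
    by (simp add: not_frequently)
  then obtain U where U: "\<forall>z\<in>C. openin X (U z) \<and> z \<in> U z \<and> (\<forall>\<^sub>F i in F. P i \<longrightarrow> u i \<notin> U z)"
    by (rule bchoice[THEN exE])
  obtain D where D: "finite D" "D \<subseteq> C" "C \<subseteq> (\<Union>z\<in>D. U z)"
    by (rule compactin_indexed_subcover[OF assms(1), of C U]) (use U in blast)+
  have "\<forall>\<^sub>F i in F. \<forall>z\<in>D. P i \<longrightarrow> u i \<notin> U z"
    using D U by (intro eventually_ball_finite) auto
  then have "\<forall>\<^sub>F i in F. \<not> P i"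
    by (rule eventually_mono) (use D(3) assms(3) in blast)
  then show False using assms(2) by (simp add: frequently_def)
qed

text \<open>The sequence \<open>d\<close> enumerates the rational linear combinations of the
  \<open>x n\<close>, coded by lists of index-coefficient pairs so that countability is automatic;
  its closure is the closed span.\<close>

lemma countable_dense_closed_subspace:
  fixes x :: "nat \<Rightarrow> 'a::real_normed_vector"
  obtains d :: "nat \<Rightarrow> 'a" where "subspace (closure (range d))" "range x \<subseteq> range d"
proof -
  define g where "g = (\<lambda>l :: (nat \<times> rat) list. \<Sum>(n, q)\<leftarrow>l. real_of_rat q *\<^sub>R x n)"
  have g_append: "g (l @ l') = g l + g l'" for l l' by (simp add: g_def)
  have g_scale: "real_of_rat q *\<^sub>R g l = g (map (map_prod id ((*) q)) l)" for q l
    by (induction l) (auto simp: g_def scaleR_add_right of_rat_mult)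
  have sub: "subspace (closure (range g))"
  proof (rule subspaceI)
    have "g [] \<in> closure (range g)" by (intro subsetD[OF closure_subset]) blast
    then show "0 \<in> closure (range g)" by (simp add: g_def)
  next
    fix a b assume "a \<in> closure (range g)" "b \<in> closure (range g)"
    then have "a + b \<in> closure (range g) + closure (range g)" by (rule set_plus_intro)
    also have "\<dots> \<subseteq> closure (range g + range g)" by (rule closure_sum)
    also have "\<dots> \<subseteq> closure (range g)"
      by (intro closure_mono) (auto elim!: set_plus_elim simp flip: g_append)
    finally show "a + b \<in> closure (range g)" .
  next
    fix c a assume a: "a \<in> closure (range g)"
    have "(\<lambda>v. real_of_rat q *\<^sub>R v) ` closure (range g) \<subseteq> closure (range g)" for q
      by (intro image_closure_subset continuous_intros) (auto simp: g_scale intro: subsetD[OF closure_subset])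
    then have "real_of_rat q *\<^sub>R a \<in> closure (range g)" for q using a by blast
    \<comment> \<open>Rational scalars are settled; real ones follow by continuity in the scalar and
      density of the rationals.\<close>
    moreover have "(\<lambda>c. c *\<^sub>R a) ` closure (\<rat> :: real set) \<subseteq> closure (range g)"
      by (intro image_closure_subset continuous_intros) (use calculation in \<open>auto elim!: Rats_cases\<close>)
    moreover have "c \<in> closure (\<rat> :: real set)"
      unfolding closure_approachable
    proof (intro strip)
      fix e :: real assume "e > 0"
      then obtain q where "q \<in> \<rat>" "c < q" "q < c + e"
        using Rats_dense_in_real[of c "c + e"] by auto
      then show "\<exists>q\<in>\<rat>. dist q c < e" by (intro bexI[of _ q]) (auto simp: dist_real_def)
    qed
    ultimately show "c *\<^sub>R a \<in> closure (range g)" by blast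
  qed
  have range: "range (g \<circ> from_nat) = range g"
    by (metis surj_from_nat image_comp)
  show thesis
  proof (rule that)
    show "subspace (closure (range (g \<circ> from_nat)))" unfolding range by (rule sub)
    have "x n = g [(n, 1)]" for n by (simp add: g_def)
    then show "range x \<subseteq> range (g \<circ> from_nat)" unfolding range by blast
  qed
qed

text \<open>Bolzano-Weierstrass for each row, followed by a diagonal argument.\<close>

lemma simultaneous_convergent_subsequence:
  fixes a :: "nat \<Rightarrow> nat \<Rightarrow> real"
  assumes "\<And>j. bounded (range (a j))"
  obtains r :: "nat \<Rightarrow> nat" where "strict_mono r" "\<And>j. convergent (a j \<circ> r)"
proof -
  interpret subseqs "\<lambda>j r. convergent (a j \<circ> r)"
  proof
    fix j and s :: "nat \<Rightarrow> nat" assume "strict_mono s"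
    have "bounded (range (a j \<circ> s))" by (rule bounded_subset[OF assms[of j]]) auto
    then obtain l r where "strict_mono r" "(a j \<circ> s \<circ> r) \<longlonglongrightarrow> l"
      using bounded_imp_convergent_subsequence by blast
    then show "\<exists>r'. strict_mono r' \<and> convergent (a j \<circ> (s \<circ> r'))"
      by (auto simp: convergent_def o_assoc)
  qed
  have "convergent (a j \<circ> diagseq)" for j
  proof -
    \<comment> \<open>The diagonal sequence is only guaranteed to refine the \<open>j\<close>-th
      choice after its first \<open>Suc j\<close> terms, which do not affect convergence.\<close>
    have "convergent (a j \<circ> (diagseq \<circ> ((+) (Suc j))))"
      by (rule diagseq_holds) (simp add: o_assoc convergent_subseq_convergent)
    moreover have "a j \<circ> (diagseq \<circ> ((+) (Suc j))) = (\<lambda>n. (a j \<circ> diagseq) (n + Suc j))"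
      by (simp add: fun_eq_iff add.commute)
    ultimately show ?thesis by (simp only: convergent_ignore_initial_segment)
  qed
  then show thesis using that subseq_diagseq by blast
qed

text \<open>Countably many functionals norming a dense sequence of the closed span of the sequence
  separate points there, so that all weak cluster points of a suitable subsequence agree.\<close>

lemma weakly_compact_imp_weakly_convergent_subsequence:
  fixes C :: "'a::real_normed_vector set" and x :: "nat \<Rightarrow> 'a"
  assumes C: "weakly_compact C" and x: "\<And>n. x n \<in> C"
  obtains r :: "nat \<Rightarrow> nat" and z where "strict_mono r" "z \<in> C" "weakly_converges (x \<circ> r) z"
proof -
  obtain d :: "nat \<Rightarrow> 'a" where d: "subspace (closure (range d))" "range x \<subseteq> range d"
    by (rule countable_dense_closed_subspace[of x])
  define Y where "Y = closure (range d)"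
  have Y: "subspace Y" "closed Y" "\<And>n. x n \<in> Y"
  proof -
    show "subspace Y" "closed Y" using d(1) by (simp_all add: Y_def)
    have "range x \<subseteq> Y" unfolding Y_def using d(2) closure_subset by (rule order_trans)
    then show "x n \<in> Y" for n by blast
  qed
  have Yw: "closedin weak_topology Y"
    using Y by (intro closed_convex_imp_closedin_weak) (auto simp: subspace_imp_convex)
  have "\<exists>f :: 'a \<Rightarrow> real. bounded_linear f \<and> (\<forall>v. \<bar>f v\<bar> \<le> norm v) \<and> f (d j) = norm (d j)" for j
    by (rule norming_functional[of "d j"]) (intro exI conjI allI)
  then have "\<exists>f :: nat \<Rightarrow> 'a \<Rightarrow> real. \<forall>j. bounded_linear (f j) \<and> (\<forall>v. \<bar>f j v\<bar> \<le> norm v)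
      \<and> f j (d j) = norm (d j)"
    by (intro choice allI)
  then obtain f :: "nat \<Rightarrow> 'a \<Rightarrow> real" where f: "\<And>j. bounded_linear (f j)"
      "\<And>j v. \<bar>f j v\<bar> \<le> norm v" "\<And>j. f j (d j) = norm (d j)"
    by blast
  \<comment> \<open>For \<open>d j\<close> close to \<open>v\<close>,
    \<open>norm (d j) = f j (d j - v)\<close> is small because \<open>f j\<close> vanishes at
    \<open>v\<close>; hence \<open>v\<close> is small too.\<close>
  have sep: "v = 0" if v: "v \<in> Y" "\<And>j. f j v = 0" for v
  proof -
    have "norm v \<le> e" if "e > 0" for e
    proof -
      obtain j where j: "dist (d j) v < e / 2"
        using v(1) \<open>e > 0\<close> unfolding Y_def closure_approachable by (metis half_gt_zero rangeE)
      have "norm (d j) = f j (d j - v)"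
        using f v(2) by (simp add: linear_diff[OF bounded_linear.linear])
      also have "\<dots> \<le> norm (d j - v)" using f(2)[of j "d j - v"] by linarith
      finally show ?thesis using j norm_triangle_sub[of v "d j"]
        by (simp add: dist_norm norm_minus_commute)
    qed
    then show ?thesis using field_le_epsilon[of "norm v" 0] by simp
  qed
  obtain M where M: "\<And>c. c \<in> C \<Longrightarrow> norm c \<le> M"
    using weakly_compact_imp_bounded[OF C] by (auto simp: bounded_iff)
  have "\<bar>f j (x n)\<bar> \<le> M" for j n
    using f(2)[of j "x n"] M[OF x[of n]] by linarith
  then have "bounded (range (\<lambda>n. f j (x n)))" for j
    by (auto simp: bounded_iff)
  then obtain r :: "nat \<Rightarrow> nat" where r: "strict_mono r" "\<And>j. convergent ((\<lambda>n. f j (x n)) \<circ> r)"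
    by (rule simultaneous_convergent_subsequence[of "\<lambda>j n. f j (x n)"]) (rule that)
  define u where "u = x \<circ> r"
  have uC: "u i \<in> C" and uY: "u i \<in> Y" for i using x Y by (simp_all add: u_def)
  \<comment> \<open>\<open>cl P z\<close> says that \<open>z\<close> is a weak cluster point of
    \<open>u\<close> along the indices satisfying \<open>P\<close>.\<close>
  define cl where "cl = (\<lambda>P z. \<forall>U. openin weak_topology U \<longrightarrow> z \<in> U \<longrightarrow>
    (\<exists>\<^sub>F i in sequentially. P i \<and> u i \<in> U))"
  have clD: "\<exists>\<^sub>F i in sequentially. P i \<and> u i \<in> U"
    if "cl P z" "openin weak_topology U" "z \<in> U" for P z U
    using that by (simp add: cl_def)
  have clY: "z \<in> Y" if "cl P z" for z P
  proof (rule ccontr)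
    assume "z \<notin> Y"
    moreover have "openin weak_topology (- Y)"
      using Yw by (simp add: closedin_def Compl_eq_Diff_UNIV[symmetric])
    ultimately have "\<exists>\<^sub>F i in sequentially. P i \<and> u i \<in> - Y"
      using clD[OF that, of "- Y"] by simp
    then show False using uY by simp
  qed
  \<comment> \<open>Since \<open>f j\<close> converges along \<open>u\<close>, its value at a
    cluster point does not depend on \<open>P\<close> or \<open>z\<close>.\<close>
  have cl_lim: "f j z = lim (\<lambda>i. f j (u i))" if "cl P z" for z P j
  proof (rule ccontr)
    define l where "l = lim (\<lambda>i. f j (u i))"
    assume "f j z \<noteq> lim (\<lambda>i. f j (u i))"
    then have "f j z \<noteq> l" by (simp add: l_def)
    from hausdorff[OF this] obtain U V
      where UV: "open U" "open V" "f j z \<in> U" "l \<in> V" "U \<inter> V = {}" by auto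
    have *: "\<exists>\<^sub>F i in sequentially. P i \<and> u i \<in> f j -` U"
      by (rule clD[OF that openin_weak_topology_vimage]) (use UV f(1) in simp_all)
    have "(\<lambda>i. f j (u i)) \<longlonglongrightarrow> l"
      using r(2)[of j] by (simp add: l_def u_def o_def convergent_LIMSEQ_iff)
    then have "\<forall>\<^sub>F i in sequentially. f j (u i) \<in> V"
      using UV(2,4) by (simp add: topological_tendstoD)
    then have "\<forall>\<^sub>F i in sequentially. \<not> (P i \<and> u i \<in> f j -` U)"
      by (rule eventually_mono) (use UV(5) in auto)
    then show False using * by (simp add: frequently_def)
  qed
  have C': "compactin weak_topology C" using C by (simp add: weakly_compact_def)
  obtain z where z: "z \<in> C" "cl (\<lambda>_. True) z"
    using compactin_frequently_cluster[OF C', of "\<lambda>_. True" sequentially u] uC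
    unfolding cl_def by auto
  have "weakly_converges u z"
    unfolding weakly_converges_def limitin_def
  proof (intro conjI allI impI)
    fix U assume U: "openin weak_topology U \<and> z \<in> U"
    show "\<forall>\<^sub>F i in sequentially. u i \<in> U"
    proof (rule ccontr)
      assume "\<not> (\<forall>\<^sub>F i in sequentially. u i \<in> U)"
      then have "\<exists>\<^sub>F i in sequentially. u i \<notin> U" by (simp add: not_eventually)
      \<comment> \<open>If \<open>u\<close> left \<open>U\<close> infinitely often, it would have a
        cluster point \<open>z'\<close> along those indices. All \<open>f j\<close> agree on
        \<open>z\<close> and \<open>z'\<close>, so \<open>z' = z\<close> lies in \<open>U\<close>,
        which is absurd.\<close>
      then obtain z' where z': "z' \<in> C" "cl (\<lambda>i. u i \<notin> U) z'"
        using compactin_frequently_cluster[OF C', of "\<lambda>i. u i \<notin> U" sequentially u] uC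
        unfolding cl_def by auto
      have "z - z' \<in> Y"
        using clY[OF z(2)] clY[OF z'(2)] Y(1) by (simp add: subspace_diff)
      moreover have "f j (z - z') = 0" for j
        using cl_lim[OF z(2), of j] cl_lim[OF z'(2), of j] f(1)[of j]
        by (simp add: linear_diff[OF bounded_linear.linear])
      ultimately have "z - z' = 0" by (rule sep)
      then show False using clD[OF z'(2), of U] U by simp
    qed
  qed simp
  then show thesis using that[OF r(1) z(1)] by (simp add: u_def)
qed

subsection \<open>Small block sums from the weak Banach--Saks property\<close>

text \<open>Ramsey's theorem for the colouring of \<open>m\<close>-element sets by \<open>Q\<close>;
  \<open>r\<close> enumerates the infinite homogeneous set.\<close>

lemma ramsey_subsequence:
  fixes Q :: "nat set \<Rightarrow> bool"
  obtains r :: "nat \<Rightarrow> nat" where "strict_mono r"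
    "(\<forall>A. finite A \<longrightarrow> card A = m \<longrightarrow> Q (r ` A)) \<or> (\<forall>A. finite A \<longrightarrow> card A = m \<longrightarrow> \<not> Q (r ` A))"
proof -
  obtain Y :: "nat set" and t :: nat where Y: "infinite Y"
    "\<forall>X. X \<subseteq> Y \<and> finite X \<and> card X = m \<longrightarrow> (if Q X then 0 else 1) = t"
  proof -
    have "\<exists>Y t. Y \<subseteq> UNIV \<and> infinite Y \<and> t < (2::nat) \<and>
        (\<forall>X. X \<subseteq> Y \<and> finite X \<and> card X = m \<longrightarrow> (if Q X then 0 else 1) = t)"
      by (rule Ramsey) auto
    then show ?thesis using that by blast
  qed
  define r where "r = enumerate Y"
  have r: "strict_mono r" using strict_mono_enumerate[OF Y(1)] by (simp add: r_def)
  have "(if Q (r ` A) then 0 else 1) = t" if "finite A" "card A = m" for A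
  proof -
    have "r ` A \<subseteq> Y" using enumerate_in_set[OF Y(1)] by (auto simp: r_def)
    moreover have "card (r ` A) = m"
      using that r by (simp add: card_image strict_mono_imp_inj_on inj_on_subset)
    ultimately show ?thesis using Y(2) that(1) by blast
  qed
  then show thesis using that[OF r] by (metis zero_neq_one)
qed

text \<open>Blocks of \<open>m\<close> indices are peeled off, each costing \<open>e * m\<close>;
  the fewer than \<open>m\<close> remaining terms cost at most \<open>M\<close> each.\<close>

lemma norm_sum_le_of_blocks:
  fixes w :: "'i \<Rightarrow> 'a::real_normed_vector" and e M :: real
  assumes m: "m > 0" and w: "\<And>k. norm (w k) \<le> M"
    and block: "\<And>B. finite B \<Longrightarrow> card B = m \<Longrightarrow> norm (\<Sum>k\<in>B. w k) \<le> e * real m"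
    and e: "0 \<le> e" and A: "finite A"
  shows "norm (\<Sum>k\<in>A. w k) \<le> e * card A + M * real m"
  using A
proof (induction "card A" arbitrary: A rule: less_induct)
  case less
  show ?case
  proof (cases "card A < m")
    case True
    have M: "0 \<le> M" using w norm_ge_zero order_trans by blast
    have "norm (\<Sum>k\<in>A. w k) \<le> card A * M" using w by (intro sum_norm_bound) auto
    also have "\<dots> \<le> M * real m" using True M by (simp add: mult.commute mult_left_mono)
    finally show ?thesis using e by (simp add: add_increasing)
  next
    case False
    then obtain B where B: "B \<subseteq> A" "card B = m" "finite B"
      by (metis not_le obtain_subset_with_card_n)
    have c: "card (A - B) = card A - m" using B by (simp add: card_Diff_subset)
    have "norm (\<Sum>k\<in>A - B. w k) \<le> e * card (A - B) + M * real m"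
      using less.hyps[of "A - B"] c m False less.prems by simp
    moreover have "(\<Sum>k\<in>A. w k) = (\<Sum>k\<in>A - B. w k) + (\<Sum>k\<in>B. w k)"
      using less.prems B(1) by (simp add: sum.subset_diff)
    ultimately have "norm (\<Sum>k\<in>A. w k) \<le> e * card (A - B) + M * m + e * real m"
      using block[OF B(3,2)] norm_triangle_ineq[of "\<Sum>k\<in>A - B. w k" "\<Sum>k\<in>B. w k"] by simp
    then show ?thesis using c False by (simp add: of_nat_diff algebra_simps)
  qed
qed

text \<open>The block sum is the difference of the centred partial sums at \<open>2 * n\<close> and
  \<open>n\<close>. Each is eventually at most \<open>e / 3\<close> times its length, and the two
  lengths add up to \<open>3 * n\<close>.\<close>

lemma cesaro_tail_block:
  fixes w :: "nat \<Rightarrow> 'a::real_normed_vector" and e :: real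
  assumes lim: "(\<lambda>n. (1 / real n) *\<^sub>R (\<Sum>i<n. w i)) \<longlonglongrightarrow> l" and e: "e > 0"
  shows "\<forall>\<^sub>F n in sequentially. norm (\<Sum>i\<in>{n..<2 * n}. w i - l) \<le> e * real n"
proof -
  define b where "b = (\<lambda>n. \<Sum>i<n. w i - l)"
  have e3: "e / 3 > 0" using e by simp
  have "\<forall>\<^sub>F n in sequentially. norm (b n) \<le> e / 3 * n"
    using tendstoD[OF lim e3] eventually_gt_at_top[of "0::nat"]
  proof (eventually_elim)
    fix n :: nat
    assume elim: "dist ((1 / real n) *\<^sub>R (\<Sum>i<n. w i)) l < e / 3" "0 < n"
    have "b n = real n *\<^sub>R ((1 / real n) *\<^sub>R (\<Sum>i<n. w i) - l)"
      using elim(2) by (simp add: b_def sum_subtractf scaleR_diff_right sum_constant_scaleR)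
    then have "norm (b n) = real n * dist ((1 / real n) *\<^sub>R (\<Sum>i<n. w i)) l"
      by (simp add: dist_norm)
    also have "\<dots> \<le> real n * (e / 3)" using elim by (intro mult_left_mono) auto
    finally show "norm (b n) \<le> e / 3 * n" by (simp add: mult.commute)
  qed
  then obtain N where N: "\<And>n. n \<ge> N \<Longrightarrow> norm (b n) \<le> e / 3 * n"
    by (auto simp: eventually_sequentially)
  have "norm (\<Sum>i\<in>{n..<2 * n}. w i - l) \<le> e * real n" if "n \<ge> N" for n
  proof -
    have "b (2 * n) = b n + (\<Sum>i\<in>{n..<2 * n}. w i - l)"
      unfolding b_def using sum.atLeastLessThan_concat[of 0 n "2 * n" "\<lambda>i. w i - l"]
      by (simp add: lessThan_atLeast0)
    then have "(\<Sum>i\<in>{n..<2 * n}. w i - l) = b (2 * n) - b n" by simp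
    then have "norm (\<Sum>i\<in>{n..<2 * n}. w i - l) \<le> norm (b (2 * n)) + norm (b n)"
      using norm_triangle_ineq4 by metis
    also have "\<dots> \<le> e / 3 * (2 * n) + e / 3 * n"
      using N[of "2 * n"] N[of n] that by simp
    finally show ?thesis by (simp add: field_simps)
  qed
  then show ?thesis by (auto simp: eventually_sequentially)
qed

text \<open>Otherwise, by Ramsey and a diagonal argument, some subsequence has large sums over all sets of
  \<open>m\<close> indices from \<open>m\<close> on, for every \<open>m > 0\<close>; no subsequence of it has convergent Cesaro means.\<close>

lemma weak_banach_saks_small_blocks:
  fixes x :: "nat \<Rightarrow> 'a::real_normed_vector" and e :: real
  assumes wbs: "weak_banach_saks C" and x: "\<And>n. x n \<in> C" and lim: "weakly_converges x l" and e: "e > 0"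
  shows "\<exists>m r :: nat \<Rightarrow> nat. m > 0 \<and> strict_mono r \<and>
    (\<forall>A. finite A \<longrightarrow> card A = m \<longrightarrow> norm (\<Sum>k\<in>A. x (r k) - l) \<le> e * real m)"
proof (rule ccontr)
  assume "\<not> ?thesis"
  then have no_good: "\<not> (\<forall>A. finite A \<longrightarrow> card A = m \<longrightarrow> norm (\<Sum>k\<in>A. x (r k) - l) \<le> e * real m)"
    if "m > 0" "strict_mono r" for m :: nat and r :: "nat \<Rightarrow> nat"
    using that by blast
  \<comment> \<open>Stage \<open>m\<close> concerns blocks of size \<open>Suc m\<close>, so that
    block sizes are positive.\<close>
  interpret subseqs "\<lambda>m r. \<forall>A. finite A \<longrightarrow> card A = Suc m \<longrightarrow> e * real (Suc m) < norm (\<Sum>k\<in>A. x (r k) - l)"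
  proof
    fix m and s :: "nat \<Rightarrow> nat" assume s: "strict_mono s"
    define Q where "Q = (\<lambda>X. norm (\<Sum>k\<in>X. x (s k) - l) \<le> e * real (Suc m))"
    obtain r :: "nat \<Rightarrow> nat" where r: "strict_mono r" "(\<forall>A. finite A \<longrightarrow> card A = Suc m \<longrightarrow> Q (r ` A)) \<or>
        (\<forall>A. finite A \<longrightarrow> card A = Suc m \<longrightarrow> \<not> Q (r ` A))"
      by (rule ramsey_subsequence[of "Suc m" Q])
    have Q: "Q (r ` A) \<longleftrightarrow> norm (\<Sum>k\<in>A. x ((s \<circ> r) k) - l) \<le> e * real (Suc m)" for A
      using r(1) by (simp add: Q_def sum.reindex strict_mono_imp_inj_on inj_on_subset[OF _ subset_UNIV])
    have "strict_mono (s \<circ> r)" using s r(1) by (simp add: strict_mono_o)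
    \<comment> \<open>The assumption excludes the homogeneous set with small sums, so Ramsey leaves
      the one on which all sums are large.\<close>
    from no_good[OF _ this, of "Suc m"]
    have "\<not> (\<forall>A. finite A \<longrightarrow> card A = Suc m \<longrightarrow> Q (r ` A))" unfolding Q by simp
    with r(2) have "\<forall>A. finite A \<longrightarrow> card A = Suc m \<longrightarrow> \<not> Q (r ` A)" by argo
    then have bad: "\<forall>A. finite A \<longrightarrow> card A = Suc m \<longrightarrow> e * real (Suc m) < norm (\<Sum>k\<in>A. x ((s \<circ> r) k) - l)"
      unfolding Q not_le .
    show "\<exists>r' :: nat \<Rightarrow> nat. strict_mono r' \<and> (\<forall>A. finite A \<longrightarrow> card A = Suc m \<longrightarrow>
        e * real (Suc m) < norm (\<Sum>k\<in>A. x ((s \<circ> r') k) - l))"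
      by (intro exI[of _ r] conjI r(1) bad)
  qed
  have diag: "e * real (Suc m) < norm (\<Sum>k\<in>A. x (diagseq (Suc m + k)) - l)"
    if "finite A" "card A = Suc m" for m A
  proof -
    have "\<forall>A. finite A \<longrightarrow> card A = Suc m \<longrightarrow>
      e * real (Suc m) < norm (\<Sum>k\<in>A. x ((diagseq \<circ> ((+) (Suc m))) k) - l)"
    proof (rule diagseq_holds, intro allI impI)
      fix r s :: "nat \<Rightarrow> nat" and n and A :: "nat set"
      assume r: "strict_mono r" and A: "finite A" "card A = Suc n"
        and *: "\<forall>A. finite A \<longrightarrow> card A = Suc n \<longrightarrow> e * real (Suc n) < norm (\<Sum>k\<in>A. x (s k) - l)"
      have inj: "inj_on r A" using r by (simp add: strict_mono_imp_inj_on inj_on_subset[OF _ subset_UNIV])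
      then have "e * real (Suc n) < norm (\<Sum>k\<in>r ` A. x (s k) - l)"
        using A by (intro *[rule_format]) (auto simp: card_image)
      then show "e * real (Suc n) < norm (\<Sum>k\<in>A. x ((s \<circ> r) k) - l)"
        by (simp add: sum.reindex[OF inj])
    qed
    then show ?thesis using that by simp
  qed
  have "weakly_converges (x \<circ> diagseq) l"
    using lim limitin_subsequence[OF subseq_diagseq] by (auto simp: weakly_converges_def)
  then obtain r :: "nat \<Rightarrow> nat" where r: "strict_mono r"
    and avg: "(\<lambda>n. (1 / real n) *\<^sub>R (\<Sum>i<n. x (diagseq (r i)))) \<longlonglongrightarrow> l"
    using wbs[unfolded weak_banach_saks_def, rule_format, of "x \<circ> diagseq" l] x by auto
  obtain N where N: "\<And>n. n \<ge> N \<Longrightarrow> norm (\<Sum>i\<in>{n..<2 * n}. x (diagseq (r i)) - l) \<le> e * real n"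
    using cesaro_tail_block[OF avg e] by (auto simp: eventually_sequentially)
  \<comment> \<open>The block length is the size handled by stage \<open>N\<close>. Because
    \<open>r i \<ge> i \<ge> n\<close> on the block, its indices can be shifted down by
    \<open>n\<close> to the form required by \<open>diag\<close>.\<close>
  define n where "n = Suc N"
  have ge: "r i \<ge> n" if "i \<in> {n..<2 * n}" for i
    using strict_mono_imp_increasing[OF r, of i] that by simp
  define A where "A = (\<lambda>i. r i - n) ` {n..<2 * n}"
  have inj: "inj_on (\<lambda>i. r i - n) {n..<2 * n}"
    using ge strict_mono_eq[OF r] by (auto simp: inj_on_def) (metis atLeastLessThan_iff eq_diff_iff)
  have "card A = Suc N" using inj by (simp add: A_def card_image n_def)
  then have "e * real n < norm (\<Sum>k\<in>A. x (diagseq (n + k)) - l)"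
    using diag[of A N] by (simp add: n_def A_def)
  also have "(\<Sum>k\<in>A. x (diagseq (n + k)) - l) = (\<Sum>i\<in>{n..<2 * n}. x (diagseq (r i)) - l)"
    unfolding A_def using ge by (subst sum.reindex[OF inj]) (auto intro!: sum.cong)
  finally show False using N[of n] by (simp add: n_def)
qed

text \<open>Blocks of one exact size \<open>m\<close> are controlled with \<open>e / 2\<close>.
  Choosing \<open>n\<close> so large that the leftover \<open>(M + norm l) * m\<close> is at most
  \<open>e / 2 * n\<close> controls all sets of at most \<open>n\<close> indices, as the supremum
  over subsets in the cm-quantity demands.\<close>

lemma weak_banach_saks_small_sums:
  fixes x :: "nat \<Rightarrow> 'a::real_normed_vector" and e :: real
  assumes wbs: "weak_banach_saks C" and x: "\<And>n. x n \<in> C" and lim: "weakly_converges x l"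
    and bdd: "bounded C" and e: "e > 0"
  obtains n and r :: "nat \<Rightarrow> nat" where "n > 0" "strict_mono r"
    "\<And>A. finite A \<Longrightarrow> card A \<le> n \<Longrightarrow> norm (\<Sum>k\<in>A. x (r k) - l) \<le> e * real n"
proof -
  have e2: "e / 2 > 0" using e by simp
  obtain m and r :: "nat \<Rightarrow> nat" where m: "m > 0" and r: "strict_mono r"
    and block: "\<And>A. finite A \<Longrightarrow> card A = m \<Longrightarrow> norm (\<Sum>k\<in>A. x (r k) - l) \<le> e / 2 * real m"
    using weak_banach_saks_small_blocks[of C x l "e / 2"] wbs x lim e2 by blast
  obtain M where M: "\<And>c. c \<in> C \<Longrightarrow> norm c \<le> M" using bdd by (auto simp: bounded_iff)
  have w: "norm (x (r k) - l) \<le> M + norm l" for k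
    using M[OF x[of "r k"]] norm_triangle_ineq4[of "x (r k)" l] by simp
  obtain n0 :: nat where n0: "(M + norm l) * m / (e / 2) \<le> real n0" using real_arch_simple by blast
  define n where "n = Suc n0"
  have n: "(M + norm l) * m \<le> e / 2 * n"
    using n0 e by (simp add: n_def field_simps)
  show thesis
  proof (rule that)
    fix A :: "nat set" assume A: "finite A" "card A \<le> n"
    have "norm (\<Sum>k\<in>A. x (r k) - l) \<le> e / 2 * card A + (M + norm l) * real m"
      by (rule norm_sum_le_of_blocks[OF m w block _ A(1)]) (use e in auto)
    also have "\<dots> \<le> e / 2 * n + e / 2 * n"
      using A(2) e n by (intro add_mono mult_left_mono) auto
    finally show "norm (\<Sum>k\<in>A. x (r k) - l) \<le> e * real n" by simp
  qed (use r in \<open>simp_all add: n_def\<close>)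
qed

subsection \<open>Minimal invariant sets\<close>

text \<open>Zorn's lemma for reversed inclusion: closed convex sets are weakly closed, so weak
  compactness keeps the intersection of a chain nonempty.\<close>

lemma minimal_invariant_subset:
  fixes C :: "'a::real_normed_vector set"
  assumes "C \<noteq> {}" and wc: "weakly_compact C" and "convex C" and "T ` C \<subseteq> C"
  obtains K where "K \<noteq> {}" "K \<subseteq> C" "closed K" "convex K" "T ` K \<subseteq> K"
    "\<And>L. L \<noteq> {} \<Longrightarrow> L \<subseteq> K \<Longrightarrow> closed L \<Longrightarrow> convex L \<Longrightarrow> T ` L \<subseteq> L \<Longrightarrow> L = K"
proof -
  define A where "A = {K. K \<noteq> {} \<and> K \<subseteq> C \<and> closed K \<and> convex K \<and> T ` K \<subseteq> K}"
  have CA: "C \<in> A" using assms weakly_compact_imp_closed by (simp add: A_def)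
  have "\<exists>m\<in>A. \<forall>a\<in>A. m \<supseteq> a \<longrightarrow> a = m"
  proof (rule predicate_Zorn)
    show "partial_order_on A (relation_of (\<lambda>a b. b \<subseteq> a) A)"
      by (rule partial_order_on_relation_ofI) auto
  next
    fix \<K> assume \<K>: "\<K> \<in> Chains (relation_of (\<lambda>a b. b \<subseteq> a) A)"
    then have KA: "\<K> \<subseteq> A" and tot: "\<And>a b. a \<in> \<K> \<Longrightarrow> b \<in> \<K> \<Longrightarrow> a \<subseteq> b \<or> b \<subseteq> a"
      by (auto simp: Chains_def relation_of_def)
    show "\<exists>u\<in>A. \<forall>a\<in>\<K>. u \<subseteq> a"
    proof (cases "\<K> = {}")
      case True
      then show ?thesis using CA by blast
    next
      case False
      \<comment> \<open>A finite nonempty part of a chain contains its own intersection, which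
        yields the finite intersection property.\<close>
      have fin: "\<F> \<noteq> {} \<Longrightarrow> \<Inter>\<F> \<in> \<F>" if "finite \<F>" "\<F> \<subseteq> \<K>" for \<F>
        using that
      proof (induction \<F> rule: finite_induct)
        case (insert K \<F>)
        show ?case
        proof (cases "\<F> = {}")
          case False
          then have "\<Inter>\<F> \<in> \<F>" using insert by simp
          then have "\<Inter>\<F> \<in> \<K>" "K \<in> \<K>" using insert.prems by auto
          then have "K \<inter> \<Inter>\<F> = K \<or> K \<inter> \<Inter>\<F> = \<Inter>\<F>" using tot by blast
          then show ?thesis using \<open>\<Inter>\<F> \<in> \<F>\<close> by auto
        qed simp
      qed simp
      have "C \<inter> \<Inter>\<F> \<noteq> {}" if F: "finite \<F>" "\<F> \<subseteq> \<K>" for \<F>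
      proof (cases "\<F> = {}")
        case True
        then show ?thesis using assms(1) by simp
      next
        case False
        then have "\<Inter>\<F> \<in> A" using fin[OF F] F(2) KA by blast
        then show ?thesis by (auto simp: A_def)
      qed
      moreover have "\<forall>K\<in>\<K>. closedin weak_topology K"
        using KA by (auto simp: A_def intro: closed_convex_imp_closedin_weak)
      ultimately have "C \<inter> \<Inter>\<K> \<noteq> {}"
        using wc unfolding weakly_compact_def compactin_fip by simp
      moreover have "\<Inter>\<K> \<subseteq> C" "closed (\<Inter>\<K>)" "convex (\<Inter>\<K>)" "T ` \<Inter>\<K> \<subseteq> \<Inter>\<K>"
        using KA False by (fastforce simp: A_def intro!: closed_Inter convex_Inter)+
      ultimately have "\<Inter>\<K> \<in> A" by (simp add: A_def) blast
      then show ?thesis by blast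
    qed
  qed
  then obtain K where K: "K \<in> A" "\<And>L. L \<in> A \<Longrightarrow> L \<subseteq> K \<Longrightarrow> L = K" by blast
  show thesis
  proof (rule that[of K])
    show "K \<noteq> {}" "K \<subseteq> C" "closed K" "convex K" "T ` K \<subseteq> K" using K(1) by (simp_all add: A_def)
    then show "L = K" if "L \<noteq> {}" "L \<subseteq> K" "closed L" "convex L" "T ` L \<subseteq> L" for L
      using that order_trans[of L K C] by (intro K(2)) (simp_all add: A_def)
  qed
qed

text \<open>The contraction \<open>S\<close>, which mixes \<open>T\<close> with a fixed point
  \<open>z\<close> of \<open>K\<close> in proportion \<open>t\<close>, has a fixed point
  \<open>v\<close>, and there \<open>T v - v\<close> is \<open>t\<close> times
  \<open>T v - z\<close>. The diameter bound \<open>2 * M\<close> and \<open>t = 1 / (n + 1)\<close>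
  give the rate.\<close>

lemma approximate_fixed_point_sequence:
  fixes K :: "'a::banach set"
  assumes "K \<noteq> {}" "closed K" "convex K" "bounded K" "T ` K \<subseteq> K" "nonexpansive_on K T"
  obtains x where "\<And>n::nat. x n \<in> K" "(\<lambda>n. T (x n) - x n) \<longlonglongrightarrow> 0"
proof -
  obtain z where z: "z \<in> K" using assms(1) by blast
  obtain M where M: "\<And>c. c \<in> K \<Longrightarrow> norm c \<le> M" using assms(4) by (auto simp: bounded_iff)
  have "\<exists>v\<in>K. norm (T v - v) \<le> 2 * M * inverse (real (Suc n))" for n
  proof -
    define t where "t = inverse (real (Suc n))"
    have t: "0 < t" "t \<le> 1" by (simp_all add: t_def field_simps)
    define S where "S = (\<lambda>v. (1 - t) *\<^sub>R T v + t *\<^sub>R z)"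
    have "\<exists>!v. v \<in> K \<and> S v = v"
    proof (rule Banach_fix)
      show "complete K" using assms(2) by (simp add: complete_eq_closed)
      show "S ` K \<subseteq> K"
        using assms(5) z t unfolding S_def by (auto intro!: convexD[OF assms(3)])
      show "dist (S v) (S w) \<le> (1 - t) * dist v w" if "v \<in> K" "w \<in> K" for v w
      proof -
        have "dist (S v) (S w) = (1 - t) * norm (T v - T w)"
          using t by (simp add: S_def dist_norm scaleR_diff_right[symmetric])
        also have "\<dots> \<le> (1 - t) * norm (v - w)"
          using assms(6) that t by (intro mult_left_mono) (auto simp: nonexpansive_on_def)
        finally show ?thesis by (simp add: dist_norm)
      qed
    qed (use t assms(1) in auto)
    then obtain v where v: "v \<in> K" "S v = v" by blast
    have "T v - v = T v - S v" by (simp add: v(2))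
    also have "\<dots> = t *\<^sub>R (T v - z)" by (simp add: S_def algebra_simps)
    finally have "norm (T v - v) = t * norm (T v - z)" using t by simp
    also have "\<dots> \<le> t * (2 * M)"
      using M[of "T v"] M[OF z] norm_triangle_ineq4[of "T v" z] v(1) assms(5) t
      by (intro mult_left_mono) auto
    finally show ?thesis using v(1) by (auto simp: t_def mult.commute)
  qed
  then obtain x where x: "\<And>n. x n \<in> K" "\<And>n. norm (T (x n) - x n) \<le> 2 * M * inverse (real (Suc n))"
    by metis
  have "(\<lambda>n. 2 * M * inverse (real (Suc n))) \<longlonglongrightarrow> 0"
    using tendsto_mult_left[OF LIMSEQ_inverse_real_of_nat, of "2 * M"] by simp
  then have "(\<lambda>n. T (x n) - x n) \<longlonglongrightarrow> 0"
    by (rule Lim_null_comparison[rotated]) (use x(2) in simp)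
  then show thesis using that x(1) by blast
qed

subsection \<open>Sublevel sets of the cm-quantity\<close>

text \<open>This trades the extended-real limsup and supremum for an \<epsilon>-statement about real
  norms, the form used in all later estimates.\<close>

lemma cm_quantity_le_iff:
  "cm_quantity n u y \<le> ereal c \<longleftrightarrow>
    (\<forall>e>0. \<forall>\<^sub>F i in sequentially. \<forall>A\<subseteq>{1..n}. norm (\<Sum>k\<in>A. u (i + k) - y) \<le> c + e)"
proof -
  define g where "g = (\<lambda>i. SUP A\<in>Pow {1..n}. ereal (norm (\<Sum>k\<in>A. u (i + k) - y)))"
  have g: "g i \<le> ereal d \<longleftrightarrow> (\<forall>A\<subseteq>{1..n}. norm (\<Sum>k\<in>A. u (i + k) - y) \<le> d)" for i d
    by (auto simp: g_def SUP_le_iff)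
  have "limsup g \<le> ereal c \<longleftrightarrow> (\<forall>e>0. \<forall>\<^sub>F i in sequentially. g i \<le> ereal (c + e))"
  proof
    assume *: "limsup g \<le> ereal c"
    show "\<forall>e>0. \<forall>\<^sub>F i in sequentially. g i \<le> ereal (c + e)"
    proof (intro allI impI)
      fix e :: real assume "e > 0"
      then have "\<forall>\<^sub>F i in sequentially. g i < ereal (c + e)"
        using * unfolding Limsup_le_iff by simp
      then show "\<forall>\<^sub>F i in sequentially. g i \<le> ereal (c + e)"
        by (rule eventually_mono) simp
    qed
  next
    assume *: "\<forall>e>0. \<forall>\<^sub>F i in sequentially. g i \<le> ereal (c + e)"
    show "limsup g \<le> ereal c"
    proof (rule ereal_le_epsilon2)
      fix e :: real assume "e > 0"
      then show "limsup g \<le> ereal c + ereal e" using * by (auto intro: Limsup_bounded)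
    qed
  qed
  moreover have "cm_quantity n u y = limsup g" by (simp only: cm_quantity_def g_def)
  ultimately show ?thesis by (simp only: g)
qed

text \<open>Moving the centre from \<open>z j\<close> to \<open>l\<close> changes each sum by
  \<open>card A \<le> n\<close> copies of \<open>z j - l\<close>, uniformly in
  \<open>i\<close>.\<close>

lemma cm_quantity_sublevel_closed: "closed {y. cm_quantity n u y \<le> ereal c}"
  unfolding closed_sequential_limits
proof (intro allI impI)
  fix z l assume zl: "(\<forall>j. z j \<in> {y. cm_quantity n u y \<le> ereal c}) \<and> z \<longlonglongrightarrow> l"
  have "\<forall>\<^sub>F i in sequentially. \<forall>A\<subseteq>{1..n}. norm (\<Sum>k\<in>A. u (i + k) - l) \<le> c + e" if e: "e > 0" for e
  proof -
    \<comment> \<open>\<open>Suc n\<close> in place of \<open>n\<close> keeps the quotient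
      meaningful for \<open>n = 0\<close>.\<close>
    define d where "d = e / (2 * real (Suc n))"
    have d: "d > 0" using e by (simp add: d_def)
    then obtain j where j: "norm (z j - l) < d"
      using zl LIMSEQ_D by blast
    have "\<forall>\<^sub>F i in sequentially. \<forall>A\<subseteq>{1..n}. norm (\<Sum>k\<in>A. u (i + k) - z j) \<le> c + e / 2"
      using zl e by (simp add: cm_quantity_le_iff)
    then show ?thesis
    proof (rule eventually_mono, intro allI impI)
      fix i A assume *: "\<forall>A\<subseteq>{1..n}. norm (\<Sum>k\<in>A. u (i + k) - z j) \<le> c + e / 2" and A: "A \<subseteq> {1..n}"
      have "card A \<le> n" using card_mono[OF _ A] by simp
      then have "card A * norm (z j - l) \<le> real (Suc n) * d"
        using j d by (intro mult_mono) auto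
      also have "\<dots> = e / 2" by (simp add: d_def field_simps)
      finally have small: "card A * norm (z j - l) \<le> e / 2" .
      have "(\<Sum>k\<in>A. u (i + k) - l) = (\<Sum>k\<in>A. u (i + k) - z j) + real (card A) *\<^sub>R (z j - l)"
        by (simp add: sum_subtractf sum_constant_scaleR scaleR_diff_right)
      then have "norm (\<Sum>k\<in>A. u (i + k) - l) \<le> norm (\<Sum>k\<in>A. u (i + k) - z j) + card A * norm (z j - l)"
        using norm_triangle_ineq[of "\<Sum>k\<in>A. u (i + k) - z j" "real (card A) *\<^sub>R (z j - l)"] by simp
      moreover have "norm (\<Sum>k\<in>A. u (i + k) - z j) \<le> c + e / 2" using * A by blast
      ultimately show "norm (\<Sum>k\<in>A. u (i + k) - l) \<le> c + e" using small by linarith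
    qed
  qed
  then show "l \<in> {y. cm_quantity n u y \<le> ereal c}" by (simp add: cm_quantity_le_iff)
qed

text \<open>For fixed \<open>i\<close> and \<open>A\<close> the sum is affine in the centre, so its
  norm is convex there.\<close>

lemma cm_quantity_sublevel_convex: "convex {y. cm_quantity n u y \<le> ereal c}"
proof (rule convexI)
  fix y z and s t :: real
  assume yz: "y \<in> {y. cm_quantity n u y \<le> ereal c}" "z \<in> {y. cm_quantity n u y \<le> ereal c}"
    and st: "0 \<le> s" "0 \<le> t" "s + t = 1"
  have "\<forall>\<^sub>F i in sequentially. \<forall>A\<subseteq>{1..n}. norm (\<Sum>k\<in>A. u (i + k) - (s *\<^sub>R y + t *\<^sub>R z)) \<le> c + e"
    if e: "e > 0" for e
  proof -
    have "\<forall>\<^sub>F i in sequentially. \<forall>A\<subseteq>{1..n}. norm (\<Sum>k\<in>A. u (i + k) - y) \<le> c + e"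
      "\<forall>\<^sub>F i in sequentially. \<forall>A\<subseteq>{1..n}. norm (\<Sum>k\<in>A. u (i + k) - z) \<le> c + e"
      using yz e by (simp_all add: cm_quantity_le_iff)
    then show ?thesis
    proof (rule eventually_elim2, intro allI impI)
      fix i A assume y: "\<forall>A\<subseteq>{1..n}. norm (\<Sum>k\<in>A. u (i + k) - y) \<le> c + e"
        and z: "\<forall>A\<subseteq>{1..n}. norm (\<Sum>k\<in>A. u (i + k) - z) \<le> c + e" and A: "A \<subseteq> {1..n}"
      have u: "u j - (s *\<^sub>R y + t *\<^sub>R z) = s *\<^sub>R (u j - y) + t *\<^sub>R (u j - z)" for j
        using scaleR_add_left[of s t "u j"] st(3) by (simp add: algebra_simps)
      have "(\<Sum>k\<in>A. u (i + k) - (s *\<^sub>R y + t *\<^sub>R z)) =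
          s *\<^sub>R (\<Sum>k\<in>A. u (i + k) - y) + t *\<^sub>R (\<Sum>k\<in>A. u (i + k) - z)"
        by (simp only: u sum.distrib scaleR_sum_right)
      also have "norm \<dots> \<le> s * norm (\<Sum>k\<in>A. u (i + k) - y) + t * norm (\<Sum>k\<in>A. u (i + k) - z)"
        using norm_triangle_ineq[of "s *\<^sub>R (\<Sum>k\<in>A. u (i + k) - y)" "t *\<^sub>R (\<Sum>k\<in>A. u (i + k) - z)"]
          st(1,2) by simp
      also have "\<dots> \<le> s * (c + e) + t * (c + e)"
        using y z A st by (intro add_mono mult_left_mono) auto
      also have "\<dots> = c + e" using st(3) by (simp flip: distrib_right)
      finally show "norm (\<Sum>k\<in>A. u (i + k) - (s *\<^sub>R y + t *\<^sub>R z)) \<le> c + e" .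
    qed
  qed
  then show "s *\<^sub>R y + t *\<^sub>R z \<in> {y. cm_quantity n u y \<le> ereal c}" by (simp add: cm_quantity_le_iff)
qed

text \<open>Sums of at most \<open>n\<close> terms change by a null sequence. With
  \<open>v = T \<circ> u\<close> this carries the bound from the image sequence back to an
  asymptotically fixed \<open>u\<close>.\<close>

lemma cm_quantity_le_of_asymptotic:
  assumes diff: "(\<lambda>i. v i - u i) \<longlonglongrightarrow> 0" and v: "cm_quantity n v y \<le> ereal c"
  shows "cm_quantity n u y \<le> ereal c"
  unfolding cm_quantity_le_iff
proof (intro allI impI)
  fix e :: real assume e: "e > 0"
  define d where "d = e / (2 * real (Suc n))"
  have d: "d > 0" using e by (simp add: d_def)
  then obtain N where N: "\<And>i. i \<ge> N \<Longrightarrow> norm (v i - u i) < d"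
    using LIMSEQ_D[OF diff] by auto
  have "\<forall>\<^sub>F i in sequentially. \<forall>A\<subseteq>{1..n}. norm (\<Sum>k\<in>A. v (i + k) - y) \<le> c + e / 2"
    using v e by (simp add: cm_quantity_le_iff)
  then show "\<forall>\<^sub>F i in sequentially. \<forall>A\<subseteq>{1..n}. norm (\<Sum>k\<in>A. u (i + k) - y) \<le> c + e"
    using eventually_ge_at_top[of N]
  proof (rule eventually_elim2, intro allI impI)
    fix i A assume i: "i \<ge> N" and A: "A \<subseteq> {1..n}"
      and *: "\<forall>A\<subseteq>{1..n}. norm (\<Sum>k\<in>A. v (i + k) - y) \<le> c + e / 2"
    have "norm (\<Sum>k\<in>A. v (i + k) - u (i + k)) \<le> (\<Sum>k\<in>A. d)"
      by (rule sum_norm_le) (use N i in \<open>simp add: less_imp_le\<close>)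
    also have "\<dots> \<le> real (Suc n) * d"
      using card_mono[OF _ A] d by (simp add: mult_right_mono)
    also have "\<dots> = e / 2" by (simp add: d_def field_simps)
    finally have small: "norm (\<Sum>k\<in>A. v (i + k) - u (i + k)) \<le> e / 2" .
    have "(\<Sum>k\<in>A. u (i + k) - y) = (\<Sum>k\<in>A. v (i + k) - y) - (\<Sum>k\<in>A. v (i + k) - u (i + k))"
      by (simp add: sum_subtractf)
    then have "norm (\<Sum>k\<in>A. u (i + k) - y) \<le>
        norm (\<Sum>k\<in>A. v (i + k) - y) + norm (\<Sum>k\<in>A. v (i + k) - u (i + k))"
      using norm_triangle_ineq4 by metis
    moreover have "norm (\<Sum>k\<in>A. v (i + k) - y) \<le> c + e / 2" using * A by blast
    ultimately show "norm (\<Sum>k\<in>A. u (i + k) - y) \<le> c + e" using small by linarith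
  qed
qed

text \<open>A functional norming \<open>x - y\<close>, applied to the sums over the full block
  \<open>{1..n}\<close>, converges to \<open>n * norm (x - y)\<close>, while it never exceeds the
  norm of these sums.\<close>

lemma cm_quantity_weak_limit_ge:
  fixes u :: "nat \<Rightarrow> 'a::real_normed_vector"
  assumes lim: "weakly_converges u x" and c: "cm_quantity n u y \<le> ereal c"
  shows "real n * norm (x - y) \<le> c"
proof (rule field_le_epsilon)
  fix e :: real assume e: "e > 0"
  obtain f :: "'a \<Rightarrow> real" where f: "bounded_linear f" "\<And>v. \<bar>f v\<bar> \<le> norm v" "f (x - y) = norm (x - y)"
    by (rule norming_functional[of "x - y"]) (rule that)
  have lin: "linear f" using f(1) by (rule bounded_linear.linear)
  have fu: "(\<lambda>i. f (u i)) \<longlonglongrightarrow> f x"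
  proof (rule topological_tendstoI)
    fix U assume "open U" "f x \<in> U"
    then have "\<forall>\<^sub>F i in sequentially. u i \<in> f -` U"
      using lim openin_weak_topology_vimage[OF f(1) \<open>open U\<close>]
      by (auto simp: weakly_converges_def limitin_def)
    then show "\<forall>\<^sub>F i in sequentially. f (u i) \<in> U" by simp
  qed
  have "(\<lambda>i. \<Sum>k\<in>{1..n}. f (u (i + k)) - f y) \<longlonglongrightarrow> (\<Sum>k\<in>{1..n}. f x - f y)"
    by (intro tendsto_sum tendsto_diff tendsto_const LIMSEQ_ignore_initial_segment[OF fu])
  moreover have "(\<Sum>k\<in>{1..n}. f x - f y) = real n * norm (x - y)"
    using linear_diff[OF lin, of x y] f(3) by simp
  ultimately have conv: "(\<lambda>i. f (\<Sum>k\<in>{1..n}. u (i + k) - y)) \<longlonglongrightarrow> real n * norm (x - y)"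
    by (simp only: linear_sum[OF lin] linear_diff[OF lin])
  have "\<forall>\<^sub>F i in sequentially. \<forall>A\<subseteq>{1..n}. norm (\<Sum>k\<in>A. u (i + k) - y) \<le> c + e"
    using c e by (simp add: cm_quantity_le_iff)
  then have "\<forall>\<^sub>F i in sequentially. f (\<Sum>k\<in>{1..n}. u (i + k) - y) \<le> c + e"
  proof (rule eventually_mono)
    fix i assume "\<forall>A\<subseteq>{1..n}. norm (\<Sum>k\<in>A. u (i + k) - y) \<le> c + e"
    then have "norm (\<Sum>k\<in>{1..n}. u (i + k) - y) \<le> c + e" by blast
    then show "f (\<Sum>k\<in>{1..n}. u (i + k) - y) \<le> c + e"
      using f(2)[of "\<Sum>k\<in>{1..n}. u (i + k) - y"] by linarith
  qed
  then show "real n * norm (x - y) \<le> c + e"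
    by (rule tendsto_upperbound[OF conv]) simp
qed

section \<open>Fixed points of cm-nonexpansive maps\<close>

theorem theorem4p4:
  fixes C :: "'a::banach set" and T :: "'a \<Rightarrow> 'a"
  assumes "C \<noteq> {}" and "weakly_compact C" and "convex C"
    and "weak_banach_saks C"
    and "cm_nonexpansive C T"
  shows "\<exists>x\<in>C. T x = x"
proof -
  have TC: "T ` C \<subseteq> C" and ne: "nonexpansive_on C T"
    and cm: "\<And>n y u. y \<in> C \<Longrightarrow> (\<And>i. u i \<in> C) \<Longrightarrow> cm_quantity n (\<lambda>i. T (u i)) (T y) \<le> cm_quantity n u y"
    using assms(5) by (auto simp: cm_nonexpansive_def)
  have bC: "bounded C" using assms(2) by (rule weakly_compact_imp_bounded)
  obtain K where K: "K \<noteq> {}" "K \<subseteq> C" "closed K" "convex K" "T ` K \<subseteq> K"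
    and min: "\<And>L. L \<noteq> {} \<Longrightarrow> L \<subseteq> K \<Longrightarrow> closed L \<Longrightarrow> convex L \<Longrightarrow> T ` L \<subseteq> L \<Longrightarrow> L = K"
    by (rule minimal_invariant_subset[OF assms(1,2,3) TC]) (rule that)
  have neK: "nonexpansive_on K T" using ne K(2) by (auto simp: nonexpansive_on_def)
  obtain v where v: "\<And>n::nat. v n \<in> K" "(\<lambda>n. T (v n) - v n) \<longlonglongrightarrow> 0"
    by (rule approximate_fixed_point_sequence[OF K(1,3,4) bounded_subset[OF bC K(2)] K(5) neK]) (rule that)
  have vC: "\<And>n. v n \<in> C" using v(1) K(2) by blast
  obtain s :: "nat \<Rightarrow> nat" and x where s: "strict_mono s" and lim: "weakly_converges (v \<circ> s) x"
    by (rule weakly_compact_imp_weakly_convergent_subsequence[OF assms(2) vC]) (rule that)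
  have xK: "x \<in> K"
  proof (rule ccontr)
    assume "x \<notin> K"
    moreover have "openin weak_topology (- K)"
      using closed_convex_imp_closedin_weak[OF K(3,4)]
      by (simp add: closedin_def Compl_eq_Diff_UNIV[symmetric])
    ultimately have "\<forall>\<^sub>F i in sequentially. (v \<circ> s) i \<in> - K"
      using lim by (auto simp: weakly_converges_def limitin_def)
    then show False using v(1) by simp
  qed
  have "y = x" if y: "y \<in> K" for y
  proof (rule ccontr)
    assume "y \<noteq> x"
    \<comment> \<open>Half the distance, so that the concluding bound
      \<open>norm (x - y) \<le> e\<close> is contradictory.\<close>
    define e where "e = norm (x - y) / 2"
    have e: "e > 0" using \<open>y \<noteq> x\<close> by (simp add: e_def)
    obtain n :: nat and r :: "nat \<Rightarrow> nat" where n: "n > 0" and r: "strict_mono r"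
      and small: "\<And>A. finite A \<Longrightarrow> card A \<le> n \<Longrightarrow> norm (\<Sum>k\<in>A. (v \<circ> s) (r k) - x) \<le> e * real n"
      by (rule weak_banach_saks_small_sums[OF assms(4) _ lim bC e]) (use vC in simp, rule that)
    define u where "u = v \<circ> s \<circ> r"
    have uC: "\<And>i. u i \<in> C" using vC by (simp add: u_def)
    have ulim: "weakly_converges u x"
      using lim limitin_subsequence[OF r] by (simp add: weakly_converges_def u_def)
    have uafp: "(\<lambda>i. T (u i) - u i) \<longlonglongrightarrow> 0"
      using LIMSEQ_subseq_LIMSEQ[OF v(2) strict_mono_o[OF s r]] by (simp add: u_def o_def)
    define L where "L = K \<inter> {z. cm_quantity n u z \<le> ereal (e * real n)}"
    have "L = K"
    proof (rule min)
      \<comment> \<open>Shifting \<open>A\<close> by \<open>i\<close> gives another set of at most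
        \<open>n\<close> indices, so the small-sum bound holds for every \<open>i\<close> and in
        particular in the limit.\<close>
      have "norm (\<Sum>k\<in>A. u (i + k) - x) \<le> e * real n + d" if A: "A \<subseteq> {1..n}" and d: "d > 0" for A i d
      proof -
        have fin: "finite A" using A by (rule finite_subset) simp
        have inj: "inj_on ((+) i) A" by simp
        have "card ((+) i ` A) \<le> n"
          using card_mono[OF _ A] card_image[OF inj] by simp
        then have "norm (\<Sum>k\<in>(+) i ` A. u k - x) \<le> e * real n"
          using small[of "(+) i ` A"] fin by (simp add: u_def)
        also have "(\<Sum>k\<in>(+) i ` A. u k - x) = (\<Sum>k\<in>A. u (i + k) - x)"
          by (simp add: sum.reindex[OF inj])
        finally show ?thesis using d by linarith
      qed
      then have "cm_quantity n u x \<le> ereal (e * real n)" by (simp add: cm_quantity_le_iff)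
      then show "L \<noteq> {}" using xK by (auto simp: L_def)
      show "L \<subseteq> K" by (simp add: L_def)
      show "closed L" unfolding L_def using K(3) cm_quantity_sublevel_closed by (rule closed_Int)
      show "convex L" unfolding L_def using K(4) cm_quantity_sublevel_convex by (rule convex_Int)
      show "T ` L \<subseteq> L"
      proof (rule image_subsetI)
        fix z assume z: "z \<in> L"
        then have "cm_quantity n (\<lambda>i. T (u i)) (T z) \<le> cm_quantity n u z"
          using K(2) uC by (intro cm) (auto simp: L_def)
        also have "\<dots> \<le> ereal (e * real n)" using z by (simp add: L_def)
        finally have "cm_quantity n u (T z) \<le> ereal (e * real n)"
          by (rule cm_quantity_le_of_asymptotic[OF uafp])
        then show "T z \<in> L" using z K(5) by (auto simp: L_def)
      qed
    qed
    then have "cm_quantity n u y \<le> ereal (e * real n)" using y by (auto simp: L_def)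
    then have "real n * norm (x - y) \<le> e * real n"
      by (rule cm_quantity_weak_limit_ge[OF ulim])
    then have "norm (x - y) \<le> e" using n by (simp add: mult.commute)
    then show False using e by (simp add: e_def)
  qed
  moreover have "T x \<in> K" using K(5) xK by blast
  ultimately have "T x = x" by blast
  then show ?thesis using xK K(2) by blast
qed

end
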